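(* Let $r$ be a positive integer. The threshold for growing paths is $1+a(\mathrm{PSG}_r)$. That is, for each fixed integer $k$ with $0\le k\le r!$, as $n\to\infty$: $f(n,r,k)=O(1)$ if $k\le a(\mathrm{PSG}_r)$, and $f(n,r,k)=\omega(1)$ (i.e. $f(n,r,k)\to\infty$) if $k>a(\mathrm{PSG}_r)$.
   Context: An $r$-digraph $G$ consists of a finite vertex set $V(G)$ and an edge set $E(G)$ whose elements are ordered lists of $r$ distinct vertices. An $(r,k)$-tournament is an $r$-digraph $G$ such that for every $r$-element set $S\subseteq V(G)$, exactly $k$ of the $r!$ orderings of $S$ are edges of $G$. The tight path $P^{(r)}_s$ is the $r$-digraph with $s$ distinct vertices $v_1,\ldots,v_s$ whose edges are exactly the lists of $r$ consecutive vertices $(v_i,\ldots,v_{i+r-1})$, $1\le i\le s-r+1$ (no edges if $s<r$). An $r$-digraph $G$ contains $P^{(r)}_s$ if there is an injection of its vertices into $V(G)$ mapping edges to edges. $f(n,r,k)$ is the maximum integer $s$ such that every $n$-vertex $(r,k)$-tournament contains a copy of $P^{(r)}_s$. The threshold for growing paths is the minimum $k$ such that $f(n,r,k)\to\infty$ as $n\to\infty$. Two lists $(a_1,\ldots,a_s)$ and $(b_1,\ldots,b_s)$, each with distinct entries, pattern-match if for all $i<j$ we have $a_i<a_j$ if and only if $b_i<b_j$. The pattern-shift graph $\mathrm{PSG}_r$ is the digraph (loops allowed) whose vertices are the permutations of $[r]=\{1,\ldots,r\}$ written as lists, with an edge from $a$ to $b$ (possibly $a=b$) if and only if the list of the last $r-1$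 entries of $a$ and the list of the first $r-1$ entries of $b$ pattern-match. For a digraph $G$, $a(G)$ is the maximum size of a set of vertices inducing an acyclic subgraph, i.e. one with no directed cycle (loops count as cycles of length 1, and directed 2-cycles count as cycles). *)

theory Defs
  imports Complex_Main "HOL-Library.Landau_Symbols" "HOL-Combinatorics.Multiset_Permutations"
begin

text \<open>An \<open>r\<close>-digraph is given by its vertex set \<open>V\<close> and its edge set \<open>E\<close>.\<close>

definition r_digraph :: "nat \<Rightarrow> 'a set \<Rightarrow> 'a list set \<Rightarrow> bool" where
  "r_digraph r V E \<longleftrightarrow>
     finite V \<and> (\<forall>e\<in>E. length e = r \<and> distinct e \<and> set e \<subseteq> V)"

definition rk_tournament :: "nat \<Rightarrow> nat \<Rightarrow> 'a set \<Rightarrow> 'a list set \<Rightarrow> bool" where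
  "rk_tournament r k V E \<longleftrightarrow>
     r_digraph r V E \<and>
     (\<forall>S. S \<subseteq> V \<and> card S = r \<longrightarrow> card (permutations_of_set S \<inter> E) = k)"

text \<open>The vertex \<open>v\<^sub>i\<close> of the tight path is represented by the number \<open>i\<close>.\<close>

definition tight_path_verts :: "nat \<Rightarrow> nat set" where
  "tight_path_verts s = {1..s}"

definition tight_path_edges :: "nat \<Rightarrow> nat \<Rightarrow> nat list set" where
  "tight_path_edges r s = {[i..<i + r] | i. 1 \<le> i \<and> i + r \<le> s + 1}"

definition contains_tight_path :: "nat \<Rightarrow> nat \<Rightarrow> 'a set \<Rightarrow> 'a list set \<Rightarrow> bool" where
  "contains_tight_path r s V E \<longleftrightarrow>
     (\<exists>\<phi>. inj_on \<phi> (tight_path_verts s) \<and> \<phi> ` tight_path_verts s \<subseteq> V \<and>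
          (\<forall>e\<in>tight_path_edges r s. map \<phi> e \<in> E))"

text \<open>
  Vertices are natural numbers without loss of generality, since every finite \<open>r\<close>-digraph is
  isomorphic to one on natural numbers.  The maximum is only meaningful for \<open>k \<le> r!\<close>; it is
  then taken over a finite nonempty set (lemmas \<open>finite_forced_lengths\<close> and
  \<open>zero_in_forced_lengths\<close>), whereas for \<open>k > r!\<close> and \<open>n \<ge> r\<close> there are no tournaments.
\<close>

definition forced_lengths :: "nat \<Rightarrow> nat \<Rightarrow> nat \<Rightarrow> nat set" where
  "forced_lengths n r k =
     {s. \<forall>(V :: nat set) E. rk_tournament r k V E \<and> card V = n \<longrightarrow> contains_tight_path r s V E}"

definition forced_path :: "nat \<Rightarrow> nat \<Rightarrow> nat \<Rightarrow> nat" where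
  "forced_path n r k = Max (forced_lengths n r k)"

definition growing_path_threshold :: "nat \<Rightarrow> nat" where
  "growing_path_threshold r =
     (LEAST k. k \<le> fact r \<and> filterlim (\<lambda>n. forced_path n r k) at_top sequentially)"

text \<open>Only applied to lists with distinct entries.\<close>

definition pattern_match :: "nat list \<Rightarrow> nat list \<Rightarrow> bool" where
  "pattern_match a b \<longleftrightarrow>
     length a = length b \<and>
     (\<forall>i j. i < j \<and> j < length a \<longrightarrow> (a ! i < a ! j \<longleftrightarrow> b ! i < b ! j))"

definition PSG_verts :: "nat \<Rightarrow> nat list set" where
  "PSG_verts r = permutations_of_set {1..r}"

definition PSG_edges :: "nat \<Rightarrow> (nat list \<times> nat list) set" where
  "PSG_edges r =
     {(a, b). a \<in> PSG_verts r \<and> b \<in> PSG_verts r \<and> pattern_match (tl a) (butlast b)}"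

text \<open>\<open>max_acyclic V A\<close> is \<open>a(G)\<close> for the digraph \<open>G\<close> with finite vertex set \<open>V\<close> and arc set \<open>A\<close>.\<close>

definition max_acyclic :: "'a set \<Rightarrow> ('a \<times> 'a) set \<Rightarrow> nat" where
  "max_acyclic V A = Max {card S | S. S \<subseteq> V \<and> acyclic (A \<inter> S \<times> S)}"

lemma zero_in_forced_lengths:
  assumes "1 \<le> r"
  shows "0 \<in> forced_lengths n r k"
  using assms
  by (auto simp: forced_lengths_def contains_tight_path_def tight_path_verts_def
        tight_path_edges_def)

lemma ex_rk_tournament:
  assumes "finite V" "k \<le> fact r"
  shows "\<exists>E. rk_tournament r k V E"
proof -
  have "\<exists>T. T \<subseteq> permutations_of_set S \<and> card T = k" if "S \<subseteq> V" "card S = r" for S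
  proof -
    have "finite S" using that(1) assms(1) by (rule finite_subset)
    then have "k \<le> card (permutations_of_set S)"
      using assms(2) that(2) by simp
    then show ?thesis by (meson obtain_subset_with_card_n)
  qed
  then obtain T where T: "\<And>S. S \<subseteq> V \<Longrightarrow> card S = r \<Longrightarrow>
      T S \<subseteq> permutations_of_set S \<and> card (T S) = k"
    by metis
  define E where "E = (\<Union>S\<in>{S. S \<subseteq> V \<and> card S = r}. T S)"
  have "length e = r \<and> distinct e \<and> set e \<subseteq> V" if "e \<in> E" for e
  proof -
    from that obtain S where S: "S \<subseteq> V" "card S = r" "e \<in> T S"
      unfolding E_def by blast
    then have "e \<in> permutations_of_set S" using T by blast
    then have "set e = S" "distinct e" by (auto dest: permutations_of_setD)
    then show ?thesis using S distinct_card by metis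
  qed
  then have "r_digraph r V E"
    using assms(1) unfolding r_digraph_def by blast
  moreover have "permutations_of_set S \<inter> E = T S" if S: "S \<subseteq> V" "card S = r" for S
  proof (intro equalityI subsetI)
    fix e assume e: "e \<in> permutations_of_set S \<inter> E"
    then obtain S' where S': "S' \<subseteq> V" "card S' = r" "e \<in> T S'"
      unfolding E_def by blast
    then have "e \<in> permutations_of_set S'" using T by blast
    then have "S' = S" using e permutations_of_setD(1) by blast
    then show "e \<in> T S" using S' by simp
  next
    fix e assume "e \<in> T S"
    then show "e \<in> permutations_of_set S \<inter> E"
      unfolding E_def using T S by blast
  qed
  ultimately have "rk_tournament r k V E"
    using T unfolding rk_tournament_def by simp
  then show ?thesis by blast
qed

lemma finite_forced_lengths:
  assumes "k \<le> fact r"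
  shows "finite (forced_lengths n r k)"
proof -
  obtain E where E: "rk_tournament r k {..<n} E"
    using ex_rk_tournament[of "{..<n}" k r] assms by auto
  have "s \<le> n" if "s \<in> forced_lengths n r k" for s
  proof -
    have "contains_tight_path r s {..<n} E"
      using that E by (auto simp: forced_lengths_def)
    then obtain \<phi> where "inj_on \<phi> {1..s}" "\<phi> ` {1..s} \<subseteq> {..<n}"
      by (auto simp: contains_tight_path_def tight_path_verts_def)
    then have "card {1..s} \<le> card {..<n}"
      by (meson card_inj_on_le finite_lessThan)
    then show ?thesis by simp
  qed
  then have "forced_lengths n r k \<subseteq> {..n}" by auto
  then show ?thesis using finite_subset by blast
qed

end

theory Submission
  imports Defs "HOL-Library.Ramsey"
begin

text \<open>
  If \<open>k \<le> a(PSG\<^sub>r)\<close>, take an acyclic set \<open>Q\<close> of \<open>k\<close> patterns and let the edges be the lists of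
  vertices with a pattern in \<open>Q\<close>.  Consecutive edges of a tight path follow an arc of the
  pattern-shift graph, so a tight path has at most \<open>k\<close> edges.  If \<open>k > a(PSG\<^sub>r)\<close>, colour every
  \<open>r\<close>-set with the set of patterns of its edges.  By Ramsey's theorem there is a large set of
  vertices with a common set \<open>Q\<close> of \<open>k\<close> patterns; \<open>Q\<close> induces a cycle, hence supports infinite
  walks, and every finite walk is realised as the sequence of window patterns of some list
  of numbers.
\<close>

section \<open>Patterns\<close>

lemma pattern_match_sym: "pattern_match a b \<Longrightarrow> pattern_match b a"
  unfolding pattern_match_def by auto

lemma pattern_match_trans: "pattern_match a b \<Longrightarrow> pattern_match b c \<Longrightarrow> pattern_match a c"
  unfolding pattern_match_def by auto

lemma pattern_match_tl: "pattern_match a b \<Longrightarrow> pattern_match (tl a) (tl b)"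
  unfolding pattern_match_def by (auto simp: nth_tl)

lemma pattern_match_butlast: "pattern_match a b \<Longrightarrow> pattern_match (butlast a) (butlast b)"
  unfolding pattern_match_def by (auto simp: nth_butlast)

lemma pattern_match_map:
  assumes "strict_mono_on A g" "set a \<subseteq> A"
  shows "pattern_match a (map g a)"
  unfolding pattern_match_def
proof (intro conjI allI impI)
  fix i j assume "i < j \<and> j < length a"
  moreover from this have "a ! i \<in> A" "a ! j \<in> A"
    using assms(2) by auto
  ultimately show "a ! i < a ! j \<longleftrightarrow> map g a ! i < map g a ! j"
    using strict_mono_on_less[OF assms(1)] by simp
qed simp

text \<open>The definition compares positions in one direction only. Distinctness supplies the
  other: where entries differ, the failure of one strict inequality is the opposite one.\<close>

lemma pattern_match_less_iff:
  assumes "pattern_match a b" "distinct a" "distinct b" "i < length a" "j < length a"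
  shows "a ! i < a ! j \<longleftrightarrow> b ! i < b ! j"
proof -
  have len: "length b = length a"
    using assms(1) unfolding pattern_match_def by simp
  consider "i < j" | "i = j" | "j < i" by linarith
  then show ?thesis
  proof cases
    case 3
    then have "a ! j < a ! i \<longleftrightarrow> b ! j < b ! i"
      using assms unfolding pattern_match_def by blast
    moreover have "a ! i \<noteq> a ! j" "b ! i \<noteq> b ! j"
      using 3 assms len by (auto simp: nth_eq_iff_index_eq)
    ultimately show ?thesis by linarith
  qed (use assms in \<open>auto simp: pattern_match_def\<close>)
qed

text \<open>An element of a finite set of numbers is determined by its rank, the number of smaller
  elements. Counted over positions instead of values, the rank of the entry at position
  \<open>i\<close> depends on the pattern alone, so both lists have entries of equal rank
  there.\<close>

lemma pattern_match_unique:
  assumes "pattern_match a b" "distinct a" "distinct b" "set a = set b"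
  shows "a = b"
proof (rule nth_equalityI)
  show len: "length a = length b"
    using assms(1) unfolding pattern_match_def by simp
  fix i assume i: "i < length a"
  have rank: "card {y \<in> set c. y < c ! i} = card {j. j < length c \<and> c ! j < c ! i}"
    if "distinct c" for c :: "nat list"
  proof -
    have "{y \<in> set c. y < c ! i} = (!) c ` {j. j < length c \<and> c ! j < c ! i}"
      by (auto simp: in_set_conv_nth)
    moreover have "inj_on ((!) c) {j. j < length c \<and> c ! j < c ! i}"
      using that by (auto simp: inj_on_def nth_eq_iff_index_eq)
    ultimately show ?thesis by (simp add: card_image)
  qed
  have "{j. j < length a \<and> a ! j < a ! i} = {j. j < length b \<and> b ! j < b ! i}"
    using pattern_match_less_iff[OF assms(1-3) _ i] len by auto
  then have *: "card {y \<in> set a. y < a ! i} = card {y \<in> set a. y < b ! i}"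
    using rank[OF assms(2)] rank[OF assms(3)] assms(4) by simp
  have card_less: "card {y \<in> set a. y < u} < card {y \<in> set a. y < v}"
    if "u \<in> set a" "u < v" for u v
    by (rule psubset_card_mono) (use that in auto)
  have "a ! i \<in> set a" "b ! i \<in> set a"
    using nth_mem[of i a] nth_mem[of i b] i len unfolding assms(4) by simp_all
  then show "a ! i = b ! i"
    using card_less[of "a ! i" "b ! i"] card_less[of "b ! i" "a ! i"] * by linarith
qed

text \<open>\<open>place S p\<close> is the ordering of the set \<open>S\<close> with pattern \<open>p\<close>.\<close>

definition place :: "nat set \<Rightarrow> nat list \<Rightarrow> nat list" where
  "place S p = map (\<lambda>i. sorted_list_of_set S ! (i - 1)) p"

lemma PSG_vertsD:
  assumes "p \<in> PSG_verts r"
  shows "set p = {1..r}" "distinct p" "length p = r"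
proof -
  show *: "set p = {1..r}" "distinct p"
    using assms unfolding PSG_verts_def by (auto dest: permutations_of_setD)
  show "length p = r"
    using distinct_card[OF *(2)] *(1) by simp
qed

lemma finite_PSG_verts: "finite (PSG_verts r)"
  unfolding PSG_verts_def by simp

lemma card_PSG_verts: "card (PSG_verts r) = fact r"
  unfolding PSG_verts_def by simp

lemma strict_mono_place:
  assumes "finite S" "card S = r"
  shows "strict_mono_on {1..r} (\<lambda>i. sorted_list_of_set S ! (i - 1))"
proof (rule strict_mono_onI)
  fix i j assume "i \<in> {1..r}" "j \<in> {1..r}" "i < j"
  then show "sorted_list_of_set S ! (i - 1) < sorted_list_of_set S ! (j - 1)"
    using assms strict_sorted_list_of_set[of S]
    by (intro sorted_wrt_nth_less[where P = "(<)"]) auto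
qed

lemma place_image:
  assumes "finite S" "card S = r"
  shows "(\<lambda>i. sorted_list_of_set S ! (i - 1)) ` {1..r} = S"
proof -
  have "{..<r} = (\<lambda>i. i - 1) ` {1..r}"
    by (force simp: image_iff intro: bexI[of _ "Suc _"])
  moreover have "(!) (sorted_list_of_set S) ` {..<r} = S"
    using assms nth_image[of r "sorted_list_of_set S"] by (simp add: lessThan_atLeast0)
  ultimately show ?thesis by (simp add: image_image)
qed

text \<open>The increasing enumeration of \<open>S\<close> is a bijection from
  \<open>{1..r}\<close>, so it carries permutations to permutations. This identifies the orderings
  of any \<open>r\<close>-set with the vertices of the pattern-shift graph.\<close>

lemma permutations_of_set_place:
  assumes "finite S" "card S = r"
  shows "permutations_of_set S = place S ` PSG_verts r"
  using permutations_of_set_image_inj[OF strict_mono_on_imp_inj_on[OF strict_mono_place[OF assms]]]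
  unfolding place_image[OF assms] PSG_verts_def place_def .

lemma inj_on_place:
  assumes "finite S" "card S = r"
  shows "inj_on (place S) (PSG_verts r)"
  by (rule eq_card_imp_inj_on)
    (simp_all add: assms finite_PSG_verts card_PSG_verts flip: permutations_of_set_place)

lemma pattern_match_place:
  assumes "finite S" "card S = r" "p \<in> PSG_verts r"
  shows "pattern_match p (place S p)"
  unfolding place_def
  by (rule pattern_match_map[OF strict_mono_place[OF assms(1,2)]])
    (simp add: PSG_vertsD[OF assms(3)])

text \<open>Both sides order the same set with the same pattern, so they agree by
  \<open>pattern_match_unique\<close>. Thus an edge can be recovered from its vertex set and its
  pattern.\<close>

lemma place_eq:
  assumes "p \<in> PSG_verts r" "pattern_match p w" "distinct w"
  shows "place (set w) p = w"
proof -
  have "length w = r"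
    using assms(2) PSG_vertsD[OF assms(1)] unfolding pattern_match_def by simp
  then have c: "card (set w) = r"
    using assms(3) distinct_card by blast
  have "place (set w) p \<in> permutations_of_set (set w)"
    using permutations_of_set_place[OF _ c] assms(1) by simp
  then have "set (place (set w) p) = set w" "distinct (place (set w) p)"
    by (auto dest: permutations_of_setD)
  moreover have "pattern_match (place (set w) p) w"
    using pattern_match_place[OF _ c assms(1)] assms(2) pattern_match_sym pattern_match_trans
    by blast
  ultimately show ?thesis using pattern_match_unique assms(3) by blast
qed

section \<open>Acyclic sets of patterns\<close>

lemma acyclic_Int_mono:
  assumes "acyclic (A \<inter> S \<times> S)" "T \<subseteq> S"
  shows "acyclic (A \<inter> T \<times> T)"
  using acyclic_subset[OF assms(1), of "A \<inter> T \<times> T"] assms(2) by auto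

lemma max_acyclic_props:
  assumes "finite V"
  shows max_acyclic_attained:
      "\<exists>S \<subseteq> V. card S = max_acyclic V A \<and> acyclic (A \<inter> S \<times> S)"
    and max_acyclic_upper:
      "\<And>S. S \<subseteq> V \<Longrightarrow> acyclic (A \<inter> S \<times> S) \<Longrightarrow> card S \<le> max_acyclic V A"
proof -
  let ?C = "{card S | S. S \<subseteq> V \<and> acyclic (A \<inter> S \<times> S)}"
  have fin: "finite ?C"
    by (rule finite_subset[of _ "card ` Pow V"]) (use assms in auto)
  have "card {} \<in> ?C" by (rule CollectI, rule exI[of _ "{}"]) (simp add: acyclic_def)
  then have "max_acyclic V A \<in> ?C"
    unfolding max_acyclic_def using fin by (intro Max_in) auto
  then show "\<exists>S \<subseteq> V. card S = max_acyclic V A \<and> acyclic (A \<inter> S \<times> S)" by auto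
  show "card S \<le> max_acyclic V A" if "S \<subseteq> V" "acyclic (A \<inter> S \<times> S)" for S
    unfolding max_acyclic_def by (rule Max_ge[OF fin]) (use that in auto)
qed

lemma ex_acyclic_card:
  assumes "finite V" "k \<le> max_acyclic V A"
  shows "\<exists>S \<subseteq> V. card S = k \<and> acyclic (A \<inter> S \<times> S)"
proof -
  obtain S where S: "S \<subseteq> V" "card S = max_acyclic V A" "acyclic (A \<inter> S \<times> S)"
    using max_acyclic_attained[OF assms(1)] by blast
  obtain T where T: "T \<subseteq> S" "card T = k"
    using obtain_subset_with_card_n[of k S] S(2) assms(2) by metis
  then show ?thesis using S acyclic_Int_mono by (metis subset_trans)
qed

text \<open>The increasing permutation carries a loop, so no acyclic set contains it. Hence
  \<open>1 + a(PSG)\<close> is still an admissible number of edges per \<open>r\<close>-set.\<close>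

lemma max_acyclic_PSG_less: "max_acyclic (PSG_verts r) (PSG_edges r) < fact r"
proof -
  obtain S where S: "S \<subseteq> PSG_verts r" "card S = max_acyclic (PSG_verts r) (PSG_edges r)"
      "acyclic (PSG_edges r \<inter> S \<times> S)"
    using max_acyclic_attained[OF finite_PSG_verts] by blast
  define p where "p = [1..<Suc r]"
  have p: "p \<in> PSG_verts r"
    unfolding p_def PSG_verts_def by (rule permutations_of_setI) auto
  have "pattern_match (tl p) (butlast p)"
    unfolding pattern_match_def p_def by (auto simp: nth_tl nth_butlast simp del: upt_Suc)
  then have "(p, p) \<in> PSG_edges r"
    unfolding PSG_edges_def using p by simp
  then have "p \<notin> S"
    using S(3) unfolding acyclic_def by blast
  then have "card S < card (PSG_verts r)"
    using S(1) p by (intro psubset_card_mono finite_PSG_verts) auto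
  then show ?thesis using S(2) card_PSG_verts by simp
qed

text \<open>A walk with more than \<open>card S\<close> vertices repeats one by the pigeonhole
  principle, and the stretch between two occurrences is a cycle.\<close>

lemma acyclic_walk_length:
  assumes "finite S" "acyclic (A \<inter> S \<times> S)"
    and "\<And>i. i < m \<Longrightarrow> f i \<in> S" "\<And>i. Suc i < m \<Longrightarrow> (f i, f (Suc i)) \<in> A"
  shows "m \<le> card S"
proof (rule ccontr)
  assume "\<not> m \<le> card S"
  moreover have "card (f ` {..<m}) \<le> card S"
    using assms(1,3) by (intro card_mono) auto
  ultimately have "\<not> inj_on f {..<m}"
    using card_image by fastforce
  then obtain i j where ij: "i < j" "j < m" "f i = f j"
    unfolding inj_on_def by (metis lessThan_iff linorder_neqE_nat)
  have "(f i, f (i + Suc d)) \<in> (A \<inter> S \<times> S)\<^sup>+" if "i + Suc d < m" for d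
    using that
  proof (induction d)
    case 0
    then show ?case using assms(3)[of i] assms(3)[of "Suc i"] assms(4)[of i] by auto
  next
    case (Suc d)
    then have "(f (i + Suc d), f (i + Suc (Suc d))) \<in> A \<inter> S \<times> S"
      using assms(3)[of "i + Suc d"] assms(3)[of "i + Suc (Suc d)"] assms(4)[of "i + Suc d"]
      by auto
    with Suc show ?case by (auto intro: trancl_into_trancl)
  qed
  from this[of "j - i - 1"] show False
    using ij assms(2) unfolding acyclic_def by auto
qed

text \<open>Well-founded relations are acyclic, so the converse of \<open>R\<close> is not
  well-founded; an infinite descending chain of the converse is an infinite walk along
  \<open>R\<close>.\<close>

lemma infinite_walk:
  assumes "\<not> acyclic R"
  shows "\<exists>f. \<forall>i. (f i, f (Suc i)) \<in> R"
proof -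
  have "\<not> wf (R\<inverse>)"
    using assms wf_acyclic acyclic_converse by blast
  then show ?thesis
    unfolding wf_iff_no_infinite_down_chain by auto
qed

section \<open>Few patterns: bounded paths\<close>

lemma forced_path_le:
  assumes "1 \<le> r" and "k \<le> max_acyclic (PSG_verts r) (PSG_edges r)"
  shows "forced_path n r k \<le> k + r"
proof -
  obtain Q where Q: "Q \<subseteq> PSG_verts r" "card Q = k" "acyclic (PSG_edges r \<inter> Q \<times> Q)"
    using ex_acyclic_card[OF finite_PSG_verts assms(2)] by blast
  define V where "V = {..<n}"
  define E where "E = {place S p | S p. S \<subseteq> V \<and> card S = r \<and> p \<in> Q}"
  have fin: "finite S" if "S \<subseteq> V" for S
    using that unfolding V_def by (rule finite_subset) simp
  have placed: "place S p \<in> permutations_of_set S" if "S \<subseteq> V" "card S = r" "p \<in> Q" for S p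
    using permutations_of_set_place[OF fin that(2)] that Q(1) by auto
  have edgeD: "length e = r \<and> distinct e \<and> set e \<subseteq> V \<and> (\<exists>p \<in> Q. pattern_match p e)"
    if e: "e \<in> E" for e
  proof -
    obtain S p where S: "e = place S p" "S \<subseteq> V" "card S = r" "p \<in> Q"
      using e unfolding E_def by blast
    then have "e \<in> permutations_of_set S"
      using placed by blast
    then have "set e = S" "distinct e"
      by (auto dest: permutations_of_setD)
    moreover have "pattern_match p e"
      using pattern_match_place[OF fin S(3)] S Q(1) by blast
    ultimately show ?thesis using S distinct_card by metis
  qed
  have "card (permutations_of_set S \<inter> E) = k" if S: "S \<subseteq> V" "card S = r" for S
  proof -
    \<comment> \<open>An edge determines its vertex set, so the edges on \<open>S\<close> are
      exactly those placed on \<open>S\<close> itself, one for each pattern in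
      \<open>Q\<close>.\<close>
    have "permutations_of_set S \<inter> E = place S ` Q"
    proof (intro equalityI subsetI)
      fix e assume e: "e \<in> permutations_of_set S \<inter> E"
      then obtain S' p where S': "e = place S' p" "S' \<subseteq> V" "card S' = r" "p \<in> Q"
        unfolding E_def by blast
      then have "S' = S"
        using e placed[OF S'(2-4)] by (auto dest!: permutations_of_setD(1))
      then show "e \<in> place S ` Q" using S' by blast
    next
      fix e assume "e \<in> place S ` Q"
      then obtain p where p: "e = place S p" "p \<in> Q" by blast
      then have "e \<in> E"
        using S unfolding E_def by (intro CollectI exI[of _ S] exI[of _ p]) simp
      then show "e \<in> permutations_of_set S \<inter> E"
        using placed[OF S p(2)] p(1) by simp
    qed
    moreover have "inj_on (place S) Q"
      using inj_on_subset[OF inj_on_place[OF fin S(2)] Q(1)] S(1) by blast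
    ultimately show ?thesis using card_image Q(2) by metis
  qed
  then have T: "rk_tournament r k V E"
    unfolding rk_tournament_def r_digraph_def using edgeD by (simp add: V_def)
  have bound: "s \<le> k + r" if s: "s \<in> forced_lengths n r k" for s
  proof -
    have "contains_tight_path r s V E"
      using s T unfolding forced_lengths_def V_def by auto
    then obtain \<phi> where \<phi>: "\<And>e. e \<in> tight_path_edges r s \<Longrightarrow> map \<phi> e \<in> E"
      unfolding contains_tight_path_def by blast
    \<comment> \<open>Windows are counted from 0 and path vertices from 1. Only the first
      \<open>s - r\<close> windows are used; the truncated subtraction also covers paths without
      edges.\<close>
    define w where "w i = map \<phi> [Suc i..<Suc i + r]" for i
    have "w i \<in> E" if "i < s - r" for i
      unfolding w_def
      by (rule \<phi>, unfold tight_path_edges_def, intro CollectI exI[of _ "Suc i"])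
        (use that in simp)
    then have "\<forall>i. \<exists>q. i < s - r \<longrightarrow> q \<in> Q \<and> pattern_match q (w i)"
      using edgeD by blast
    then obtain p where p: "\<And>i. i < s - r \<Longrightarrow> p i \<in> Q \<and> pattern_match (p i) (w i)"
      using choice[of "\<lambda>i q. i < s - r \<longrightarrow> q \<in> Q \<and> pattern_match q (w i)"] by blast
    \<comment> \<open>Consecutive windows share \<open>r - 1\<close> vertices, which turns the
      sequence of their patterns into a walk in the pattern-shift graph.\<close>
    have overlap: "tl (w i) = butlast (w (Suc i))" for i
      unfolding w_def using assms(1)
      by (intro nth_equalityI) (auto simp: nth_tl nth_butlast simp del: upt_Suc)
    have "pattern_match (tl (p i)) (butlast (p (Suc i)))" if "Suc i < s - r" for i
    proof (rule pattern_match_trans)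
      show "pattern_match (tl (p i)) (tl (w i))"
        using pattern_match_tl p[of i] that by simp
      show "pattern_match (tl (w i)) (butlast (p (Suc i)))"
        using pattern_match_sym[OF pattern_match_butlast] p[of "Suc i"] that
        unfolding overlap by simp
    qed
    then have "(p i, p (Suc i)) \<in> PSG_edges r" if "Suc i < s - r" for i
      unfolding PSG_edges_def using p[of i] p[of "Suc i"] that Q(1) by auto
    then have "s - r \<le> card Q"
      using p Q finite_subset[OF Q(1) finite_PSG_verts]
      by (intro acyclic_walk_length[where f = p]) auto
    then show ?thesis using Q(2) by simp
  qed
  \<comment> \<open>This makes the set of forced lengths finite, so that its \<open>Max\<close> is
    itself a forced length and obeys the bound.\<close>
  have "k \<le> fact r"
    using assms(2) max_acyclic_PSG_less[of r] by linarith
  moreover have "forced_lengths n r k \<noteq> {}"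
    using zero_in_forced_lengths[OF assms(1)] by blast
  ultimately have "forced_path n r k \<in> forced_lengths n r k"
    unfolding forced_path_def by (intro Max_in finite_forced_lengths)
  then show ?thesis by (rule bound)
qed

section \<open>Many patterns: long paths\<close>

text \<open>
  Doubling all entries to odd numbers leaves an even number free in every gap, so that the new
  last entry can be put into any prescribed relative position.
\<close>

lemma extend_realisation:
  assumes "r \<ge> 1" "length q = r" "distinct q" "distinct z" "pattern_match (butlast q) z"
  obtains y where "even y" "pattern_match q (map (\<lambda>x. 2 * x + 1) z @ [y])"
proof -
  define l where "l = r - 1"
  have len: "length z = l" "length (butlast q) = l"
    using assms unfolding pattern_match_def l_def by auto
  have less: "q ! i < q ! j \<longleftrightarrow> z ! i < z ! j" if "i < l" "j < l" for i j
    using pattern_match_less_iff[OF assms(5) distinct_butlast[OF assms(3)] assms(4), of i j] that len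
    by (simp add: nth_butlast)
  \<comment> \<open>\<open>Max Y\<close> is the even number just above the largest doubled entry
    that has to lie below the new one. The element 0 serves the case that no entry has to lie below
    it.\<close>
  define Y where "Y = insert 0 ((\<lambda>i. 2 * z ! i + 2) ` {i. i < l \<and> q ! i < q ! l})"
  have Y: "finite Y" "Y \<noteq> {}" unfolding Y_def by auto
  have "Max Y \<in> Y" using Y by (rule Max_in)
  then have even: "even (Max Y)" unfolding Y_def by auto
  have gap: "q ! i < q ! l \<longleftrightarrow> 2 * z ! i + 1 < Max Y" if i: "i < l" for i
  proof
    assume "q ! i < q ! l"
    then have "2 * z ! i + 2 \<in> Y" using i unfolding Y_def by auto
    then have "2 * z ! i + 2 \<le> Max Y" using Y by (intro Max_ge)
    then show "2 * z ! i + 1 < Max Y" by simp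
  next
    \<comment> \<open>Here \<open>Max Y\<close> is not 0, so it comes from some \<open>j\<close>
      with \<open>q ! j < q ! l\<close>. Parity gives \<open>z ! i \<le> z ! j\<close>, hence
      \<open>q ! i \<le> q ! j\<close>.\<close>
    assume *: "2 * z ! i + 1 < Max Y"
    then obtain j where j: "j < l" "q ! j < q ! l" "Max Y = 2 * z ! j + 2"
      using \<open>Max Y \<in> Y\<close> unfolding Y_def by auto
    then have "\<not> z ! j < z ! i" using * by auto
    then have "\<not> q ! j < q ! i" using less i j by blast
    then show "q ! i < q ! l" using j by simp
  qed
  have "pattern_match q (map (\<lambda>x. 2 * x + 1) z @ [Max Y])"
    unfolding pattern_match_def
  proof (intro conjI allI impI)
    show "length q = length (map (\<lambda>x. 2 * x + 1) z @ [Max Y])"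
      using assms(1,2) len l_def by simp
    fix i j assume ij: "i < j \<and> j < length q"
    show "q ! i < q ! j \<longleftrightarrow>
      (map (\<lambda>x. 2 * x + 1) z @ [Max Y]) ! i < (map (\<lambda>x. 2 * x + 1) z @ [Max Y]) ! j"
    proof (cases "j = l")
      case True
      then show ?thesis using gap[of i] ij len by (simp add: nth_append)
    next
      case False
      then have "j < l" using ij assms(2) l_def by auto
      then show ?thesis using less[of i j] ij len by (simp add: nth_append)
    qed
  qed
  then show ?thesis using even that by blast
qed

text \<open>By induction on \<open>m\<close>, appending one entry at a time. Earlier windows are
  only rescaled by a strictly increasing map, which preserves their patterns; the arc from
  \<open>f m\<close> to \<open>f (Suc m)\<close> says that the last \<open>r - 1\<close> entries can
  be continued to a window with the next pattern.\<close>

lemma walk_realisation: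
  assumes r: "r \<ge> 1" and f: "\<And>i. (f i, f (Suc i)) \<in> PSG_edges r"
  shows "\<exists>xs. length xs = m + r \<and> distinct xs \<and>
    (\<forall>i\<le>m. pattern_match (f i) (take r (drop i xs)))"
proof (induction m)
  case 0
  have "f 0 \<in> PSG_verts r"
    using f[of 0] unfolding PSG_edges_def by auto
  note PSG_vertsD[OF this]
  then show ?case
    by (intro exI[of _ "f 0"]) (simp add: pattern_match_def)
next
  case (Suc m)
  then obtain xs where xs: "length xs = m + r" "distinct xs"
    and match: "\<And>i. i \<le> m \<Longrightarrow> pattern_match (f i) (take r (drop i xs))" by blast
  let ?g = "\<lambda>x::nat. 2 * x + 1"
  let ?z = "drop (Suc m) xs"
  have "f (Suc m) \<in> PSG_verts r"
    using f[of m] unfolding PSG_edges_def by auto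
  note q = PSG_vertsD[OF this]
  have "tl (take r (drop m xs)) = ?z"
    using xs(1) by (simp add: drop_Suc flip: tl_drop)
  then have "pattern_match (tl (f m)) ?z"
    using pattern_match_tl[OF match[of m]] by simp
  moreover have "pattern_match (tl (f m)) (butlast (f (Suc m)))"
    using f[of m] unfolding PSG_edges_def by auto
  ultimately have "pattern_match (butlast (f (Suc m))) ?z"
    using pattern_match_sym pattern_match_trans by blast
  then obtain y where y: "even y" "pattern_match (f (Suc m)) (map ?g ?z @ [y])"
    using extend_realisation[OF r q(3,2)] xs(2) distinct_drop by blast
  have mono: "strict_mono_on UNIV ?g" by (rule strict_mono_onI) simp
  have "pattern_match (f i) (take r (drop i (map ?g xs @ [y])))" if "i \<le> Suc m" for i
  proof (cases "i = Suc m")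
    case True
    have "take r (drop i (map ?g xs @ [y])) = map ?g ?z @ [y]"
      using True xs(1) r by (simp add: drop_map)
    then show ?thesis using y True by simp
  next
    case False
    then have "i \<le> m" using that by simp
    then have "take r (drop i (map ?g xs @ [y])) = map ?g (take r (drop i xs))"
      using xs(1) by (simp add: drop_map take_map)
    then show ?thesis
      using match[OF \<open>i \<le> m\<close>] pattern_match_map[OF mono] pattern_match_trans by (metis subset_UNIV)
  qed
  \<comment> \<open>The rescaled entries are odd and the new one is even.\<close>
  moreover have "distinct (map ?g xs @ [y])"
    using xs(2) y(1) by (auto simp: distinct_map inj_on_def)
  ultimately show ?case
    using xs(1) by (intro exI[of _ "map ?g xs @ [y]"]) simp
qed

text \<open>This is Ramsey's theorem for colours numbered below \<open>card C\<close> on subsets of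
  \<open>{..<N}\<close>, transported along an injection of \<open>{..<N}\<close> into
  \<open>V\<close> and a numbering \<open>h\<close> of the colours. The bound \<open>N\<close> is
  chosen before \<open>V\<close> and \<open>c\<close>.\<close>

lemma finite_colour_ramsey:
  fixes C :: "'c set"
  assumes "finite C"
  shows "\<exists>N. \<forall>(V :: 'a set) c.
    finite V \<and> N \<le> card V \<and> (\<forall>S \<subseteq> V. card S = r \<longrightarrow> c S \<in> C) \<longrightarrow>
    (\<exists>W \<subseteq> V. card W = m \<and> (\<exists>Q. \<forall>S \<subseteq> W. card S = r \<longrightarrow> c S = Q))"
proof -
  obtain N :: nat where N: "partn_lst {..<N} (replicate (card C) m) r"
    using ramsey_full by blast
  obtain h where h: "bij_betw h C {0..<card C}"
    using ex_bij_betw_finite_nat[OF assms] by blast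
  have "\<exists>W \<subseteq> V. card W = m \<and> (\<exists>Q. \<forall>S \<subseteq> W. card S = r \<longrightarrow> c S = Q)"
    if V: "finite V" "card V \<ge> N"
      and c: "\<And>S. S \<subseteq> V \<Longrightarrow> card S = r \<Longrightarrow> c S \<in> C" for V :: "'a set" and c
  proof -
    obtain b where b: "inj_on b {..<N}" "b ` {..<N} \<subseteq> V"
      using V card_le_inj[of "{..<N}" V] by auto
    have im: "b ` X \<subseteq> V" "card (b ` X) = card X" if "X \<subseteq> {..<N}" for X
      using b that card_image[OF inj_on_subset[OF b(1) that]] by auto
    have "(\<lambda>X. h (c (b ` X))) \<in> nsets {..<N} r \<rightarrow> {..<card C}"
    proof
      fix X assume "X \<in> nsets {..<N} r"
      then have "c (b ` X) \<in> C"
        using im c by (auto simp: nsets_def)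
      then show "h (c (b ` X)) \<in> {..<card C}"
        using h bij_betwE by fastforce
    qed
    then obtain i H where H: "i < card C" "H \<in> nsets {..<N} m"
        "\<And>X. X \<in> nsets H r \<Longrightarrow> h (c (b ` X)) = i"
      using N unfolding partn_lst_def monochromatic_def by fastforce
    then have sub: "H \<subseteq> {..<N}" and card: "card (b ` H) = m"
      using im by (auto simp: nsets_def)
    have "c S = inv_into C h i" if S: "S \<subseteq> b ` H" "card S = r" for S
    proof -
      obtain X where X: "X \<subseteq> H" "S = b ` X"
        using S(1) by (meson subset_imageE)
      then have "X \<in> nsets H r"
        using S im[of X] sub finite_subset[of X "{..<N}"] by (auto simp: nsets_def)
      moreover have "c S \<in> C"
        using c[OF subset_trans[OF S(1) im(1)[OF sub]] S(2)] .
      ultimately show ?thesis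
        using H(3)[of X] X(2) bij_betw_inv_into_left[OF h, of "c S"] by simp
    qed
    then show ?thesis
      using im(1)[OF sub] card by (intro exI[of _ "b ` H"]) auto
  qed
  then show ?thesis by (intro exI[of _ N] allI impI) simp
qed

text \<open>For each of the finitely many \<open>k\<close>-sets \<open>Q\<close> of patterns, a walk
  in \<open>Q\<close> and a list realising it are fixed before any tournament is considered. The
  size of the homogeneous set can then be chosen large enough for all these lists at once.\<close>

lemma eventually_forced:
  assumes r: "r \<ge> 1" and k: "k > max_acyclic (PSG_verts r) (PSG_edges r)"
  obtains N where "\<And>n. n \<ge> N \<Longrightarrow> m + r \<in> forced_lengths n r k"
proof -
  have "\<exists>xs. length xs = m + r \<and> distinct xs \<and>
      (\<forall>i\<le>m. pattern_match (f i) (take r (drop i xs)))"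
    if "\<forall>i. (f i, f (Suc i)) \<in> PSG_edges r" for f
    using walk_realisation[OF r] that by blast
  then obtain X where X: "\<And>f. \<forall>i. (f i, f (Suc i)) \<in> PSG_edges r \<Longrightarrow>
      length (X f) = m + r \<and> distinct (X f) \<and>
      (\<forall>i\<le>m. pattern_match (f i) (take r (drop i (X f))))"
    by metis
  define good where "good Q f \<longleftrightarrow> (\<forall>i. (f i, f (Suc i)) \<in> PSG_edges r \<inter> Q \<times> Q)" for Q f
  have "\<exists>f. good Q f" if "Q \<subseteq> PSG_verts r" "card Q = k" for Q
    unfolding good_def
    by (rule infinite_walk) (use max_acyclic_upper[OF finite_PSG_verts that(1)] that(2) k in force)
  then obtain F where F: "\<And>Q. Q \<subseteq> PSG_verts r \<Longrightarrow> card Q = k \<Longrightarrow> good Q (F Q)"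
    by metis
  \<comment> \<open>All entries of the chosen lists are below \<open>M\<close>, so they can serve as
    indices into a set of size \<open>M\<close>. The summand \<open>r\<close> ensures that this set
    has a subset of size \<open>r\<close>. Sets \<open>Q\<close> of other sizes contribute arbitrary
    but finite lists.\<close>
  define M where "M = r + Suc (Max (\<Union>Q \<in> Pow (PSG_verts r). set (X (F Q))))"
  obtain N where N: "\<forall>(V :: nat set) c.
    finite V \<and> N \<le> card V \<and> (\<forall>S \<subseteq> V. card S = r \<longrightarrow> c S \<in> Pow (PSG_verts r)) \<longrightarrow>
    (\<exists>W \<subseteq> V. card W = M \<and> (\<exists>Q. \<forall>S \<subseteq> W. card S = r \<longrightarrow> c S = Q))"
    using finite_colour_ramsey[of "Pow (PSG_verts r)" r M] finite_PSG_verts by auto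
  have "contains_tight_path r (m + r) V E"
    if T: "rk_tournament r k V E" and V: "card V \<ge> N" for V :: "nat set" and E
  proof -
    have fin: "finite V"
      and cardE: "\<And>S. S \<subseteq> V \<Longrightarrow> card S = r \<Longrightarrow> card (permutations_of_set S \<inter> E) = k"
      using T unfolding rk_tournament_def r_digraph_def by auto
    define c where "c S = {p \<in> PSG_verts r. place S p \<in> E}" for S
    have cE: "card (c S) = k" if S: "S \<subseteq> V" "card S = r" for S
    proof -
      have fS: "finite S" using S(1) fin by (rule finite_subset)
      have "permutations_of_set S \<inter> E = place S ` c S"
        unfolding c_def permutations_of_set_place[OF fS S(2)] by auto
      moreover have "inj_on (place S) (c S)"
        using inj_on_place[OF fS S(2)] by (rule inj_on_subset) (auto simp: c_def)
      ultimately show ?thesis using cardE[OF S] card_image by metis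
    qed
    obtain W Q where W: "W \<subseteq> V" "card W = M"
      and Q: "\<And>S. S \<subseteq> W \<Longrightarrow> card S = r \<Longrightarrow> c S = Q"
    proof -
      have "\<forall>S \<subseteq> V. card S = r \<longrightarrow> c S \<in> Pow (PSG_verts r)"
        unfolding c_def by auto
      then have "\<exists>W \<subseteq> V. card W = M \<and> (\<exists>Q. \<forall>S \<subseteq> W. card S = r \<longrightarrow> c S = Q)"
        using N fin V by simp
      then show ?thesis using that by blast
    qed
    have fW: "finite W" using W(1) fin by (rule finite_subset)
    have "r \<le> card W" using W(2) M_def by simp
    \<comment> \<open>One \<open>r\<close>-subset of \<open>W\<close> shows that the common value
      \<open>Q\<close> really occurs as a colour, hence is a set of \<open>k\<close>
      patterns.\<close>
    then obtain S0 where S0: "S0 \<subseteq> W" "card S0 = r" "finite S0"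
      by (rule obtain_subset_with_card_n)
    then have "Q = c S0" using Q by blast
    then have Qv: "Q \<subseteq> PSG_verts r" and "card Q = k"
      using cE[of S0] S0 W(1) by (auto simp: c_def)
    then have g: "good Q (F Q)" by (rule F)
    define f where "f = F Q"
    have fQ: "f i \<in> Q" for i
      using g unfolding good_def f_def by blast
    define xs where "xs = X f"
    have xs: "length xs = m + r" "distinct xs"
      and match: "\<And>i. i \<le> m \<Longrightarrow> pattern_match (f i) (take r (drop i xs))"
      using X[of f] g unfolding xs_def good_def f_def by auto
    have xsM: "set xs \<subseteq> {..<card W}"
    proof
      fix x assume "x \<in> set xs"
      then have "x \<le> Max (\<Union>Q \<in> Pow (PSG_verts r). set (X (F Q)))"
        using Qv finite_PSG_verts[of r] unfolding xs_def f_def by (intro Max_ge) auto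
      then show "x \<in> {..<card W}"
        using W(2) M_def by simp
    qed
    \<comment> \<open>The increasing enumeration of \<open>W\<close> moves the list
      \<open>xs\<close> into \<open>W\<close> without changing any window pattern.\<close>
    obtain h :: "nat \<Rightarrow> nat" where h: "strict_mono_on {..<card W} h" "\<And>i. i < card W \<Longrightarrow> h i \<in> W"
      using finite_enumerate[OF fW] by blast
    define ys where "ys = map h xs"
    have ys: "length ys = m + r" "distinct ys" "set ys \<subseteq> W"
      using xs xsM h inj_on_subset[OF strict_mono_on_imp_inj_on[OF h(1)] xsM]
      unfolding ys_def by (auto simp: distinct_map)
    have edge: "take r (drop i ys) \<in> E" if i: "i \<le> m" for i
    proof -
      let ?w = "take r (drop i ys)"
      have wW: "set ?w \<subseteq> W" and dw: "distinct ?w" and lw: "length ?w = r"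
        using ys i set_take_subset[of r "drop i ys"] set_drop_subset[of i ys] by auto
      have "set (take r (drop i xs)) \<subseteq> {..<card W}"
        using xsM set_take_subset[of r "drop i xs"] set_drop_subset[of i xs] by blast
      then have "pattern_match (take r (drop i xs)) ?w"
        unfolding ys_def drop_map take_map by (rule pattern_match_map[OF h(1)])
      then have "pattern_match (f i) ?w"
        using match[OF i] pattern_match_trans by blast
      \<comment> \<open>The window is the ordering of its vertex set with pattern
        \<open>f i\<close>. Since \<open>f i\<close> belongs to \<open>Q\<close>, the colour of that
        set, this ordering is an edge.\<close>
      then have "place (set ?w) (f i) = ?w"
        using place_eq fQ Qv dw by blast
      moreover have "f i \<in> c (set ?w)"
        using Q[OF wW] dw lw fQ by (simp add: distinct_card)
      ultimately show ?thesis unfolding c_def by simp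
    qed
    define \<phi> where "\<phi> i = ys ! (i - 1)" for i
    have "inj_on \<phi> {1..m + r}"
      using ys by (auto simp: inj_on_def \<phi>_def nth_eq_iff_index_eq)
    moreover have "\<phi> ` {1..m + r} \<subseteq> V"
    proof
      fix v assume "v \<in> \<phi> ` {1..m + r}"
      then obtain i where "i \<in> {1..m + r}" "v = ys ! (i - 1)"
        unfolding \<phi>_def by blast
      then have "v \<in> set ys"
        using ys(1) by (auto intro!: nth_mem)
      then show "v \<in> V" using ys(3) W(1) by blast
    qed
    moreover have "map \<phi> e \<in> E" if "e \<in> tight_path_edges r (m + r)" for e
    proof -
      obtain i where i: "e = [i..<i + r]" "1 \<le> i" "i + r \<le> m + r + 1"
        using \<open>e \<in> _\<close> unfolding tight_path_edges_def by blast
      then have "map \<phi> e = take r (drop (i - 1) ys)"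
        using ys(1) by (intro nth_equalityI) (auto simp: \<phi>_def)
      then show ?thesis using edge[of "i - 1"] i by simp
    qed
    ultimately show ?thesis
      unfolding contains_tight_path_def tight_path_verts_def by blast
  qed
  then show ?thesis
    using that[of N] unfolding forced_lengths_def by blast
qed

lemma forced_path_at_top:
  assumes "r \<ge> 1" "k > max_acyclic (PSG_verts r) (PSG_edges r)" "k \<le> fact r"
  shows "filterlim (\<lambda>n. forced_path n r k) at_top sequentially"
  unfolding filterlim_at_top
proof
  fix m
  obtain N where N: "\<And>n. n \<ge> N \<Longrightarrow> m + r \<in> forced_lengths n r k"
    using eventually_forced[OF assms(1,2)] by blast
  have "m \<le> forced_path n r k" if "n \<ge> N" for n
    using Max_ge[OF finite_forced_lengths[OF assms(3)] N[OF that]]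
    unfolding forced_path_def by simp
  then show "eventually (\<lambda>n. m \<le> forced_path n r k) sequentially"
    unfolding eventually_sequentially by blast
qed

theorem theorem7:
  fixes r :: nat
  assumes "r \<ge> 1"
  shows "growing_path_threshold r = 1 + max_acyclic (PSG_verts r) (PSG_edges r) \<and>
         (\<forall>k \<le> fact r.
            (k \<le> max_acyclic (PSG_verts r) (PSG_edges r) \<longrightarrow>
               (\<lambda>n. real (forced_path n r k)) \<in> O(\<lambda>_. 1)) \<and>
            (k > max_acyclic (PSG_verts r) (PSG_edges r) \<longrightarrow>
               filterlim (\<lambda>n. forced_path n r k) at_top sequentially))"
proof -
  let ?a = "max_acyclic (PSG_verts r) (PSG_edges r)"
  have bounded: "(\<lambda>n. real (forced_path n r k)) \<in> O(\<lambda>_. 1)" if "k \<le> ?a" for k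
    using forced_path_le[OF assms that]
    by (intro bigoI[of _ "real (k + r)"]) (simp add: always_eventually flip: of_nat_add)
  \<comment> \<open>This excludes every smaller \<open>k\<close> from the \<open>LEAST\<close> in
    the definition of the threshold.\<close>
  have not_growing: "\<not> filterlim (\<lambda>n. forced_path n r k) at_top sequentially" if "k \<le> ?a" for k
  proof
    assume "filterlim (\<lambda>n. forced_path n r k) at_top sequentially"
    then have "eventually (\<lambda>n. k + r + 1 \<le> forced_path n r k) sequentially"
      unfolding filterlim_at_top by blast
    then obtain n where "k + r + 1 \<le> forced_path n r k"
      unfolding eventually_sequentially by blast
    then show False
      using forced_path_le[OF assms that, of n] by simp
  qed
  have "growing_path_threshold r = 1 + ?a"
    unfolding growing_path_threshold_def
  proof (rule Least_equality)
    \<comment> \<open>The candidate must itself satisfy \<open>k \<le> fact r\<close>; the loop at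
      the increasing permutation guarantees this.\<close>
    show "1 + ?a \<le> fact r \<and> filterlim (\<lambda>n. forced_path n r (1 + ?a)) at_top sequentially"
      using forced_path_at_top[OF assms, of "1 + ?a"] max_acyclic_PSG_less[of r] by simp
    show "1 + ?a \<le> k"
      if "k \<le> fact r \<and> filterlim (\<lambda>n. forced_path n r k) at_top sequentially" for k
      using not_growing[of k] that by linarith
  qed
  then show ?thesis
    using bounded forced_path_at_top[OF assms] by blast
qed

end
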